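(* For every $m\ge1$ the quaternionic reflection group $\mathrm{ST}(2m,m,2)$ of complex type has infinitely many systems of imprimitivity (in $\mathbb H^2$).
   Context: $\mathbb H$ is the real quaternion algebra with units $i,j,k$; $\mathbb C$ is identified with $\mathbb R+\mathbb Ri\subset\mathbb H$. $V=\mathbb H^2$ is the left $\mathbb H$-space of row vectors with $(u\mid v)=u_1\overline{v_1}+u_2\overline{v_2}$; matrices act by right multiplication; $\mathrm U_2(\mathbb H)$ is the group of $2\times2$ quaternionic matrices $A$ with $A\overline A^{\top}=I$. A subgroup of $\mathrm U_2(\mathbb C)$, regarded as a subgroup of $\mathrm U_2(\mathbb H)$, is said to be of complex type. $\mathrm{ST}(m,p,2)$ (with $p\mid m$) denotes the imprimitive complex reflection group $G(m,p,2)$ of Shephard and Todd (monomial $2\times2$ matrices whose non-zero entries are $m$-th roots of unity with product an $(m/p)$-th root of unity), considered as a quaternionic reflection group of complex type in $\mathrm U_2(\mathbb H)$. A system of imprimitivity for $G\subset\mathrm U_2(\mathbb H)$ is a set $\{V_1,V_2\}$ of non-zero $\mathbb H$-subspaces of $V$ with $V=V_1\oplus V_2$ which are permuted among themselves by $G$. *)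

theory Defs
  imports "HOL-Analysis.Analysis"
begin

datatype quat = Quat (qre: real) (qi: real) (qj: real) (qk: real)

lemma quat_eq_iff: "x = y \<longleftrightarrow> qre x = qre y \<and> qi x = qi y \<and> qj x = qj y \<and> qk x = qk y"
  by (cases x; cases y) auto

instantiation quat :: real_div_algebra
begin

definition "0 = Quat 0 0 0 0"
definition "1 = Quat 1 0 0 0"
definition "x + y = Quat (qre x + qre y) (qi x + qi y) (qj x + qj y) (qk x + qk y)"
definition "- x = Quat (- qre x) (- qi x) (- qj x) (- qk x)"
definition "x - y = Quat (qre x - qre y) (qi x - qi y) (qj x - qj y) (qk x - qk y)"
definition "r *\<^sub>R x = Quat (r * qre x) (r * qi x) (r * qj x) (r * qk x)"
definition "x * y = Quat
  (qre x * qre y - qi x * qi y - qj x * qj y - qk x * qk y)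
  (qre x * qi y + qi x * qre y + qj x * qk y - qk x * qj y)
  (qre x * qj y - qi x * qk y + qj x * qre y + qk x * qi y)
  (qre x * qk y + qi x * qj y - qj x * qi y + qk x * qre y)"
definition "inverse x = (let n = (qre x)\<^sup>2 + (qi x)\<^sup>2 + (qj x)\<^sup>2 + (qk x)\<^sup>2
  in Quat (qre x / n) (- qi x / n) (- qj x / n) (- qk x / n))"
definition "x div y = x * inverse (y :: quat)"

lemmas quat_defs = zero_quat_def one_quat_def plus_quat_def uminus_quat_def minus_quat_def
  scaleR_quat_def times_quat_def

lemma quat_norm_pos:
  assumes "x \<noteq> (0::quat)"
  shows "(qre x)\<^sup>2 + (qi x)\<^sup>2 + (qj x)\<^sup>2 + (qk x)\<^sup>2 > 0"
proof -
  have "qre x \<noteq> 0 \<or> qi x \<noteq> 0 \<or> qj x \<noteq> 0 \<or> qk x \<noteq> 0"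
    using assms by (auto simp: quat_eq_iff zero_quat_def)
  then show ?thesis
    by (smt (verit) zero_less_power2 zero_le_power2)
qed

instance
proof
  fix x :: quat
  assume x: "x \<noteq> 0"
  define n where "n = (qre x)\<^sup>2 + (qi x)\<^sup>2 + (qj x)\<^sup>2 + (qk x)\<^sup>2"
  have n: "n \<noteq> 0" using quat_norm_pos[OF x] unfolding n_def by linarith
  have s: "qre x * qre x / n + qi x * qi x / n + qj x * qj x / n + qk x * qk x / n = 1"
    using n unfolding n_def by (simp add: add_divide_distrib[symmetric] power2_eq_square)
  have inv: "inverse x = Quat (qre x / n) (- qi x / n) (- qj x / n) (- qk x / n)"
    by (simp add: inverse_quat_def n_def Let_def)
  show "inverse x * x = 1" "x * inverse x = 1"
    using s by (simp_all add: inv quat_eq_iff times_quat_def one_quat_def algebra_simps)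
qed (simp_all add: quat_eq_iff quat_defs divide_quat_def inverse_quat_def algebra_simps)

end

definition quat_i :: quat where "quat_i = Quat 0 1 0 0"
definition quat_j :: quat where "quat_j = Quat 0 0 1 0"
definition quat_k :: quat where "quat_k = Quat 0 0 0 1"

lemma quat_units:
  "quat_i * quat_i = -1" "quat_j * quat_j = -1" "quat_k * quat_k = -1"
  "quat_i * quat_j = quat_k" "quat_j * quat_k = quat_i" "quat_k * quat_i = quat_j"
  by (simp_all add: quat_eq_iff quat_defs quat_i_def quat_j_def quat_k_def)

lemma Quat_expand: "Quat a b c d = of_real a + of_real b * quat_i + of_real c * quat_j + of_real d * quat_k"
  by (simp add: quat_eq_iff of_real_def quat_defs quat_i_def quat_j_def quat_k_def)

definition qcnj :: "quat \<Rightarrow> quat" where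
  "qcnj x = Quat (qre x) (- qi x) (- qj x) (- qk x)"

definition quat_of_complex :: "complex \<Rightarrow> quat" where
  "quat_of_complex z = of_real (Re z) + of_real (Im z) * quat_i"

lemma quat_of_complex_Quat: "quat_of_complex z = Quat (Re z) (Im z) 0 0"
  by (simp add: quat_of_complex_def Quat_expand)

text \<open>The library product of a row vector and a matrix multiplies the entries in the order
  matrix times vector, which is the wrong order for a left module over a noncommutative ring.\<close>

definition row_mult :: "quat ^ 2 \<Rightarrow> quat ^ 2 ^ 2 \<Rightarrow> quat ^ 2" where
  "row_mult v A = (\<chi> j. \<Sum>i\<in>UNIV. v $ i * A $ i $ j)"

definition adjoint_mat :: "quat ^ 2 ^ 2 \<Rightarrow> quat ^ 2 ^ 2" where
  "adjoint_mat A = (\<chi> i j. qcnj (A $ j $ i))"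

definition U2H :: "(quat ^ 2 ^ 2) set" where
  "U2H = {A. A ** adjoint_mat A = mat 1}"

definition left_subspace :: "(quat ^ 2) set \<Rightarrow> bool" where
  "left_subspace W \<longleftrightarrow>
     0 \<in> W \<and> (\<forall>v\<in>W. \<forall>w\<in>W. v + w \<in> W) \<and> (\<forall>c. \<forall>v\<in>W. c *s v \<in> W)"

definition direct_decomposition :: "(quat ^ 2) set \<Rightarrow> (quat ^ 2) set \<Rightarrow> bool" where
  "direct_decomposition V1 V2 \<longleftrightarrow>
     (\<forall>v. \<exists>v1\<in>V1. \<exists>v2\<in>V2. v = v1 + v2) \<and> V1 \<inter> V2 = {0}"

definition system_of_imprimitivity :: "(quat ^ 2 ^ 2) set \<Rightarrow> (quat ^ 2) set set \<Rightarrow> bool" where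
  "system_of_imprimitivity G S \<longleftrightarrow>
     (\<exists>V1 V2. S = {V1, V2}
        \<and> left_subspace V1 \<and> left_subspace V2 \<and> V1 \<noteq> {0} \<and> V2 \<noteq> {0}
        \<and> direct_decomposition V1 V2)
     \<and> (\<forall>A\<in>G. (\<lambda>W. (\<lambda>v. row_mult v A) ` W) ` S = S)"

definition monomial_mat :: "complex ^ 2 ^ 2 \<Rightarrow> bool" where
  "monomial_mat A \<longleftrightarrow> (\<forall>i. \<exists>!j. A $ i $ j \<noteq> 0) \<and> (\<forall>j. \<exists>!i. A $ i $ j \<noteq> 0)"

definition shephard_todd :: "nat \<Rightarrow> nat \<Rightarrow> (complex ^ 2 ^ 2) set" where
  "shephard_todd m p = {A. monomial_mat A
     \<and> (\<forall>i j. A $ i $ j \<noteq> 0 \<longrightarrow> (A $ i $ j) ^ m = 1)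
     \<and> (\<Prod>(i, j)\<in>{(i, j). A $ i $ j \<noteq> 0}. A $ i $ j) ^ (m div p) = 1}"

definition quat_mat_of_complex :: "complex ^ 2 ^ 2 \<Rightarrow> quat ^ 2 ^ 2" where
  "quat_mat_of_complex A = (\<chi> i j. quat_of_complex (A $ i $ j))"

definition ST :: "nat \<Rightarrow> nat \<Rightarrow> (quat ^ 2 ^ 2) set" where
  "ST m p = quat_mat_of_complex ` shephard_todd m p"

lemma exists_2: "(\<exists>i::2. P i) \<longleftrightarrow> P 1 \<or> P 2"
  by (metis exhaust_2)

lemma monomial_mat_iff:
  "monomial_mat A \<longleftrightarrow>
     (A $ 1 $ 1 \<noteq> 0 \<and> A $ 2 $ 2 \<noteq> 0 \<and> A $ 1 $ 2 = 0 \<and> A $ 2 $ 1 = 0) \<or>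
     (A $ 1 $ 1 = 0 \<and> A $ 2 $ 2 = 0 \<and> A $ 1 $ 2 \<noteq> 0 \<and> A $ 2 $ 1 \<noteq> 0)"
  unfolding monomial_mat_def Ex1_def forall_2 exists_2 by auto

lemma shephard_todd_iff:
  "A \<in> shephard_todd m p \<longleftrightarrow>
     (A $ 1 $ 2 = 0 \<and> A $ 2 $ 1 = 0 \<and> A $ 1 $ 1 \<noteq> 0 \<and> A $ 2 $ 2 \<noteq> 0
       \<and> (A $ 1 $ 1) ^ m = 1 \<and> (A $ 2 $ 2) ^ m = 1 \<and> (A $ 1 $ 1 * A $ 2 $ 2) ^ (m div p) = 1) \<or>
     (A $ 1 $ 1 = 0 \<and> A $ 2 $ 2 = 0 \<and> A $ 1 $ 2 \<noteq> 0 \<and> A $ 2 $ 1 \<noteq> 0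
       \<and> (A $ 1 $ 2) ^ m = 1 \<and> (A $ 2 $ 1) ^ m = 1 \<and> (A $ 1 $ 2 * A $ 2 $ 1) ^ (m div p) = 1)"
proof -
  have "{(i, j). A $ i $ j \<noteq> 0} = {(1,1), (2,2)}"
    if "A $ 1 $ 1 \<noteq> 0 \<and> A $ 2 $ 2 \<noteq> 0 \<and> A $ 1 $ 2 = 0 \<and> A $ 2 $ 1 = 0"
    using that exhaust_2 by (auto, metis+)
  moreover have "{(i, j). A $ i $ j \<noteq> 0} = {(1,2), (2,1)}"
    if "A $ 1 $ 1 = 0 \<and> A $ 2 $ 2 = 0 \<and> A $ 1 $ 2 \<noteq> 0 \<and> A $ 2 $ 1 \<noteq> 0"
    using that exhaust_2 by (auto, metis+)
  ultimately show ?thesis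
    unfolding shephard_todd_def by (auto simp: monomial_mat_iff forall_2)
qed

lemma quat_mat_of_complex_mult:
  "quat_mat_of_complex (A ** B) = quat_mat_of_complex A ** quat_mat_of_complex B"
  by (simp add: vec_eq_iff quat_mat_of_complex_def matrix_matrix_mult_def sum_2
      quat_of_complex_Quat quat_eq_iff quat_defs)

lemma ST_one: "mat 1 \<in> ST m p"
proof -
  have "mat 1 = quat_mat_of_complex (mat 1)"
    by (auto simp: vec_eq_iff quat_mat_of_complex_def mat_def quat_of_complex_Quat quat_eq_iff quat_defs)
  moreover have "mat 1 \<in> shephard_todd m p"
    by (auto simp: shephard_todd_iff mat_def)
  ultimately show ?thesis unfolding ST_def by blast
qed

lemma ST_mult:
  assumes "A \<in> ST m p" "B \<in> ST m p"
  shows "A ** B \<in> ST m p"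
proof -
  have pw: "(a * b * (c * d)) ^ k = 1"
    if "(a * c) ^ k = 1" "(b * d) ^ k = 1 \<or> (d * b) ^ k = 1" for a b c d :: complex and k
  proof -
    have "a * b * (c * d) = (a * c) * (b * d)"
      by (simp add: algebra_simps)
    moreover have "(b * d) ^ k = 1"
      using that(2) by (auto simp: mult.commute)
    ultimately show ?thesis
      using that(1) by (simp only: power_mult_distrib[of "a * c" "b * d"] mult_1)
  qed
  have pw': "(a * b) ^ k = 1" if "a ^ k = 1" "b ^ k = 1" for a b :: complex and k
    using that by (simp only: power_mult_distrib mult_1)
  have "C ** D \<in> shephard_todd m p" if "C \<in> shephard_todd m p" "D \<in> shephard_todd m p" for C D
    using that unfolding shephard_todd_iff
    by (elim disjE; elim conjE; simp add: matrix_matrix_mult_def sum_2 pw pw')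
  moreover obtain C D where "C \<in> shephard_todd m p" "A = quat_mat_of_complex C"
      "D \<in> shephard_todd m p" "B = quat_mat_of_complex D"
    using assms unfolding ST_def by blast
  ultimately show ?thesis
    unfolding ST_def by (metis quat_mat_of_complex_mult image_eqI)
qed

lemma ST_subset_U2H:
  assumes "m \<ge> 1"
  shows "ST m p \<subseteq> U2H"
proof
  fix A assume "A \<in> ST m p"
  then obtain C where C: "C \<in> shephard_todd m p" "A = quat_mat_of_complex C"
    unfolding ST_def by blast
  have un: "Re z * Re z + Im z * Im z = 1" if "z ^ m = 1" for z
  proof -
    have "norm z ^ m = 1" using that by (metis norm_power norm_one)
    then have "norm z = 1"
      using assms power_eq_imp_eq_base[of "norm z" m 1] by simp
    then show ?thesis using cmod_power2[of z] by (simp add: power2_eq_square)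
  qed
  show "A \<in> U2H"
    using C(1) unfolding shephard_todd_iff
    by (elim disjE) (simp_all add: U2H_def C(2) vec_eq_iff forall_2 matrix_matrix_mult_def sum_2 mat_def
        adjoint_mat_def qcnj_def quat_mat_of_complex_def quat_of_complex_Quat quat_eq_iff quat_defs un)
qed

lemma ST_adjoint:
  assumes "A \<in> ST m p"
  shows "adjoint_mat A \<in> ST m p"
proof -
  obtain C where C: "C \<in> shephard_todd m p" "A = quat_mat_of_complex C"
    using assms unfolding ST_def by blast
  define D where "D = (\<chi> i j. cnj (C $ j $ i))"
  have "(C $ i $ j) ^ m = 1 \<Longrightarrow> cnj (C $ i $ j) ^ m = 1" for i j
    by (metis complex_cnj_power complex_cnj_one)
  moreover have "(C $ i $ j * C $ k $ l) ^ (m div p) = 1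
      \<Longrightarrow> (cnj (C $ i $ j) * cnj (C $ k $ l)) ^ (m div p) = 1" for i j k l
    by (metis complex_cnj_power complex_cnj_one complex_cnj_mult)
  ultimately have "D \<in> shephard_todd m p"
    using C(1) unfolding shephard_todd_iff D_def
    by (elim disjE) (auto simp: mult.commute)
  moreover have "adjoint_mat A = quat_mat_of_complex D"
    by (simp add: D_def C(2) vec_eq_iff adjoint_mat_def qcnj_def quat_mat_of_complex_def
        quat_of_complex_Quat quat_eq_iff)
  ultimately show ?thesis unfolding ST_def by blast
qed

end

(* The matrices in ST(2m,m,2) have unit entries a, b with (a b)^2 = 1, so b = e * cnj a with
   e = 1 or e = -1. For a unit quaternion q in Rj + Rk we have q^2 = -1 and z q = q cnj z for
   complex z, so a diagonal matrix sends the line H(1,q) to H(1, e q), and an antidiagonal one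
   to H(1, -e q). Thus each pair {H(1,q), H(1,-q)} is a system of imprimitivity, and q ranges
   over a circle. *)

theory Submission
  imports Defs
begin

definition slope_vec :: "quat \<Rightarrow> quat ^ 2" where
  "slope_vec q = vector [1, q]"

text \<open>Every line of the left space H^2 except the span of (0, 1) has this form, so
  \<open>q\<close> serves as an affine coordinate on lines.\<close>

definition slope_line :: "quat \<Rightarrow> (quat ^ 2) set" where
  "slope_line q = range (\<lambda>c. c *s slope_vec q)"

text \<open>These are the unit quaternions that anticommute with \<open>quat_i\<close>.\<close>

definition jk_circle :: "quat set" where
  "jk_circle = {q. qre q = 0 \<and> qi q = 0 \<and> (qj q)\<^sup>2 + (qk q)\<^sup>2 = 1}"

lemma slope_vec_nth [simp]: "slope_vec q $ 1 = 1" "slope_vec q $ 2 = q"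
  by (simp_all add: slope_vec_def)

lemma mem_slope_line: "v \<in> slope_line q \<longleftrightarrow> v $ 2 = v $ 1 * q"
  by (auto simp: slope_line_def image_iff vec_eq_iff forall_2)

lemma slope_line_inject: "slope_line q = slope_line r \<longleftrightarrow> q = r"
proof
  assume "slope_line q = slope_line r"
  moreover have "slope_vec q \<in> slope_line q"
    by (simp add: mem_slope_line)
  ultimately have "slope_vec q \<in> slope_line r"
    by simp
  then show "q = r"
    by (simp add: mem_slope_line)
qed simp

lemma left_subspace_slope_line: "left_subspace (slope_line q)"
  by (simp add: left_subspace_def mem_slope_line distrib_right mult.assoc)

lemma slope_line_neq_0: "slope_line q \<noteq> {0}"
proof -
  have "slope_vec q \<in> slope_line q" "slope_vec q \<noteq> 0"
    by (auto simp: mem_slope_line vec_eq_iff exists_2)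
  then show ?thesis by blast
qed

lemma direct_decomposition_slope_lines:
  assumes "q \<noteq> r"
  shows "direct_decomposition (slope_line q) (slope_line r)"
  unfolding direct_decomposition_def
proof (intro conjI allI)
  fix v :: "quat ^ 2"
  \<comment> \<open>Solving \<open>v = x *s slope_vec q + y *s slope_vec r\<close>: the first
    coordinate gives \<open>x = v $ 1 - y\<close>, and the second then gives
    \<open>y * (r - q) = v $ 2 - v $ 1 * q\<close>. The inverse stands on the right because scalars
    act from the left.\<close>
  define y where "y = (v $ 2 - v $ 1 * q) * inverse (r - q)"
  have y: "y * (r - q) = v $ 2 - v $ 1 * q"
    using assms by (simp add: y_def mult.assoc)
  have "v = (v $ 1 - y) *s slope_vec q + y *s slope_vec r"
    using y by (simp add: vec_eq_iff forall_2 algebra_simps)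
  then show "\<exists>v1\<in>slope_line q. \<exists>v2\<in>slope_line r. v = v1 + v2"
    unfolding slope_line_def by blast
next
  have "v = 0" if "v \<in> slope_line q" "v \<in> slope_line r" for v
  proof -
    have "v $ 1 * (q - r) = 0"
      using that by (simp add: mem_slope_line right_diff_distrib)
    then show ?thesis
      using that assms by (auto simp: mem_slope_line vec_eq_iff forall_2)
  qed
  then show "slope_line q \<inter> slope_line r = {0}"
    by (auto simp: mem_slope_line)
qed

lemma row_mult_scale: "row_mult (c *s v) A = c *s row_mult v A"
  by (simp add: row_mult_def vec_eq_iff sum_2 distrib_left mult.assoc)

text \<open>Acting by \<open>A\<close> on the right is linear for left scalars, so the image is
  spanned by the image of \<open>slope_vec q\<close>; the factor \<open>u\<close> is absorbed
  because \<open>c * u\<close> runs through all quaternions.\<close>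

lemma image_slope_line:
  assumes "row_mult (slope_vec q) A = u *s slope_vec r" "u \<noteq> 0"
  shows "(\<lambda>v. row_mult v A) ` slope_line q = slope_line r"
proof -
  have "range (\<lambda>c. c * u) = UNIV"
    using assms(2) by (intro surjI[of _ "\<lambda>c. c * inverse u"]) (simp add: mult.assoc)
  moreover have "(\<lambda>v. row_mult v A) ` slope_line q = (\<lambda>c. c *s slope_vec r) ` range (\<lambda>c. c * u)"
    by (simp add: slope_line_def image_image row_mult_scale assms(1) vector_smult_assoc)
  ultimately show ?thesis
    by (simp add: slope_line_def)
qed

lemma jk_circle_uminus: "q \<in> jk_circle \<Longrightarrow> - q \<in> jk_circle"
  by (simp add: jk_circle_def uminus_quat_def)

lemma jk_circle_square: "q \<in> jk_circle \<Longrightarrow> q * q = -1"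
  by (auto simp: jk_circle_def quat_eq_iff quat_defs power2_eq_square)

lemma quat_of_complex_commute_jk:
  "q \<in> jk_circle \<Longrightarrow> quat_of_complex z * q = q * quat_of_complex (cnj z)"
  by (simp add: jk_circle_def quat_of_complex_Quat quat_eq_iff times_quat_def)

lemma quat_of_complex_0 [simp]: "quat_of_complex 0 = 0"
  by (simp add: quat_of_complex_def)

lemma quat_of_complex_eq_0_iff: "quat_of_complex z = 0 \<longleftrightarrow> z = 0"
  by (simp add: quat_of_complex_Quat quat_eq_iff zero_quat_def complex_eq_iff)

lemma quat_of_complex_uminus: "quat_of_complex (- z) = - quat_of_complex z"
  by (simp add: quat_of_complex_Quat uminus_quat_def)

text \<open>A root of unity has modulus 1, so \<open>cnj a\<close> is its inverse and each of
  \<open>a * b = 1\<close> and \<open>a * b = -1\<close> can be solved for \<open>b\<close>.\<close>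

lemma unit_root_cofactor:
  fixes a b :: complex
  assumes "a ^ n = 1" "n > 0" "(a * b)\<^sup>2 = 1"
  shows "b = cnj a \<or> b = - cnj a"
proof -
  have "norm a = 1"
    using assms(1,2) power_eq_1_iff by blast
  then have "cnj a * a = 1"
    by (metis complex_norm_square mult.commute of_real_1 power_one)
  then have "cnj a * (a * b) = b"
    by (simp flip: mult.assoc)
  moreover have "a * b = 1 \<or> a * b = -1"
    using assms(3) by (simp only: power2_eq_1_iff)
  ultimately show ?thesis
    by (elim disjE) simp_all
qed

text \<open>The sign \<open>e\<close> depends on \<open>A\<close> alone, so it can be applied to
  \<open>q\<close> and \<open>- q\<close> at once.\<close>

lemma ST_permutes_slope_lines:
  assumes "m \<ge> 1" "A \<in> ST (2 * m) m"
  obtains e :: quat where "e = 1 \<or> e = -1"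
    "\<And>q. q \<in> jk_circle \<Longrightarrow> (\<lambda>v. row_mult v A) ` slope_line q = slope_line (e * q)"
proof -
  obtain C where C: "C \<in> shephard_todd (2 * m) m" "A = quat_mat_of_complex C"
    using assms(2) unfolding ST_def by blast
  have div: "2 * m div m = 2"
    using assms(1) by simp
  consider (diag) "C $ 1 $ 2 = 0" "C $ 2 $ 1 = 0" "C $ 1 $ 1 \<noteq> 0"
      "(C $ 1 $ 1) ^ (2 * m) = 1" "(C $ 1 $ 1 * C $ 2 $ 2)\<^sup>2 = 1"
    | (anti) "C $ 1 $ 1 = 0" "C $ 2 $ 2 = 0" "C $ 2 $ 1 \<noteq> 0"
      "(C $ 1 $ 2) ^ (2 * m) = 1" "(C $ 1 $ 2 * C $ 2 $ 1)\<^sup>2 = 1"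
    using C(1) unfolding shephard_todd_iff div by blast
  then show thesis
  proof cases
    case diag
    have "C $ 2 $ 2 = cnj (C $ 1 $ 1) \<or> C $ 2 $ 2 = - cnj (C $ 1 $ 1)"
      using assms(1) by (intro unit_root_cofactor[OF diag(4) _ diag(5)]) simp
    then obtain e :: quat where e: "e = 1 \<or> e = -1"
      "quat_of_complex (C $ 2 $ 2) = e * quat_of_complex (cnj (C $ 1 $ 1))"
      by (metis mult_1 mult_minus1 quat_of_complex_uminus)
    show thesis
    proof (rule that[OF e(1)])
      fix q assume "q \<in> jk_circle"
      \<comment> \<open>With diagonal entries a and b = e * cnj a, the image of (1, q) is (a, q *
        b), and q * cnj a = a * q turns q * b into a * (e * q).\<close>
      then have "row_mult (slope_vec q) A = quat_of_complex (C $ 1 $ 1) *s slope_vec (e * q)"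
        using e diag(1,2) quat_of_complex_commute_jk[of q "C $ 1 $ 1"]
        by (auto simp: C(2) vec_eq_iff forall_2 row_mult_def sum_2 quat_mat_of_complex_def)
      then show "(\<lambda>v. row_mult v A) ` slope_line q = slope_line (e * q)"
        using diag(3) by (simp add: image_slope_line quat_of_complex_eq_0_iff)
    qed
  next
    case anti
    have "C $ 2 $ 1 = cnj (C $ 1 $ 2) \<or> C $ 2 $ 1 = - cnj (C $ 1 $ 2)"
      using assms(1) by (intro unit_root_cofactor[OF anti(4) _ anti(5)]) simp
    \<comment> \<open>Here \<open>e\<close> is the opposite of the sign in the cofactor, which
      compensates for \<open>q * q = -1\<close> below.\<close>
    then obtain e :: quat where e: "e = 1 \<or> e = -1"
      "quat_of_complex (C $ 2 $ 1) = - e * quat_of_complex (cnj (C $ 1 $ 2))"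
      by (metis mult_1 mult_minus1 minus_minus quat_of_complex_uminus)
    show thesis
    proof (rule that[OF e(1)])
      fix q assume q: "q \<in> jk_circle"
      let ?b = "quat_of_complex (C $ 2 $ 1)"
      have "q * quat_of_complex (cnj (C $ 1 $ 2)) * q = - quat_of_complex (C $ 1 $ 2)"
        using q by (simp add: quat_of_complex_commute_jk[symmetric] mult.assoc jk_circle_square)
      \<comment> \<open>The image of (1, q) is now (q * b, a) with b = - e * cnj a; pulling out q *
        b leaves slope e * q, since q * b * (e * q) = - (q * cnj a * q) = a.\<close>
      then have "row_mult (slope_vec q) A = (q * ?b) *s slope_vec (e * q)"
        using e anti(1,2)
        by (auto simp: C(2) vec_eq_iff forall_2 row_mult_def sum_2 quat_mat_of_complex_def)
      moreover have "q * ?b \<noteq> 0"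
        using anti(3) jk_circle_square[OF q] by (auto simp: quat_of_complex_eq_0_iff)
      ultimately show "(\<lambda>v. row_mult v A) ` slope_line q = slope_line (e * q)"
        by (rule image_slope_line)
    qed
  qed
qed

lemma system_of_imprimitivity_jk_circle:
  assumes "m \<ge> 1" "q \<in> jk_circle"
  shows "system_of_imprimitivity (ST (2 * m) m) {slope_line q, slope_line (- q)}"
  unfolding system_of_imprimitivity_def
proof (intro conjI ballI)
  have "q \<noteq> - q"
    using assms(2) by (auto simp: jk_circle_def uminus_quat_def quat_eq_iff)
  then show "\<exists>V1 V2. {slope_line q, slope_line (- q)} = {V1, V2}
      \<and> left_subspace V1 \<and> left_subspace V2 \<and> V1 \<noteq> {0} \<and> V2 \<noteq> {0}
      \<and> direct_decomposition V1 V2"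
    by (intro exI[of _ "slope_line q"] exI[of _ "slope_line (- q)"])
      (simp add: left_subspace_slope_line slope_line_neq_0 direct_decomposition_slope_lines)
next
  fix A assume "A \<in> ST (2 * m) m"
  then obtain e :: quat where "e = 1 \<or> e = -1"
    "\<And>q. q \<in> jk_circle \<Longrightarrow> (\<lambda>v. row_mult v A) ` slope_line q = slope_line (e * q)"
    using ST_permutes_slope_lines[OF assms(1)] by blast
  \<comment> \<open>For \<open>e = 1\<close> both lines are preserved; for \<open>e = -1\<close>
    they are swapped.\<close>
  then show "(\<lambda>W. (\<lambda>v. row_mult v A) ` W) ` {slope_line q, slope_line (- q)}
      = {slope_line q, slope_line (- q)}"
    using assms(2) jk_circle_uminus[OF assms(2)] by auto
qed

theorem mainTheorem5:
  fixes m :: nat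
  assumes "m \<ge> 1"
  shows "infinite {S. system_of_imprimitivity (ST (2 * m) m) S}"
proof -
  \<comment> \<open>An arc of the circle parametrized by its k-coordinate. Taking 0 < s < 1 keeps
    \<open>1 - s\<^sup>2\<close> positive and the arc disjoint from its antipode.\<close>
  define q where "q s = Quat 0 0 (sqrt (1 - s\<^sup>2)) s" for s
  define T where "T s = {slope_line (q s), slope_line (- q s)}" for s
  have pos: "sqrt (1 - s\<^sup>2) > 0" if "s \<in> {0<..<1}" for s :: real
    using that by (simp add: power_less_one_iff)
  have "q s \<in> jk_circle" if "s \<in> {0<..<1}" for s
    using pos[OF that] by (simp add: q_def jk_circle_def)
  then have sub: "T ` {0<..<1} \<subseteq> {S. system_of_imprimitivity (ST (2 * m) m) S}"
    using system_of_imprimitivity_jk_circle[OF assms] by (auto simp: T_def)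
  have "inj_on T {0<..<1}"
  proof (rule inj_onI)
    fix s t :: real
    assume s: "s \<in> {0<..<1}" and t: "t \<in> {0<..<1}" and "T s = T t"
    then have "q s = q t \<or> q s = - q t"
      by (auto simp: T_def doubleton_eq_iff slope_line_inject)
    \<comment> \<open>Compare k-coordinates: the second case would give s = -t, impossible for
      positive s and t.\<close>
    then show "s = t"
      using s t by (auto simp: q_def uminus_quat_def)
  qed
  then have "infinite (T ` {0<..<1})"
    by (simp add: finite_image_iff)
  with sub show ?thesis
    using finite_subset by blast
qed

end
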